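(* (i) For any integers $a\ge 1$ and $b\ge 0$ with $b\leq a/2$, we have $$x(ax+b)+y(ay+a-b)\sim aT_x+\psi_{a,a-2b}(y).$$ (ii) We have $$x^2+T_y\sim p_5(x)+2p_5(y),$$ $$T_x+2T_y\sim p_5(x)+p_8(y),$$ $$x^2+4T_y\sim 4p_5(x)+p_8(y),$$ $$T_x+T_y\sim \psi_{5,1}(x)+\psi_{5,3}(y).$$
   Context: $\mathbb N=\{0,1,2,\ldots\}$. For polynomials $f_1,f_2,f_3,f_4$ with $f_i(\mathbb Z)\subseteq\mathbb N$ for $i=1,2,3,4$, the notation $f_1(x)+f_2(y)\sim f_3(x)+f_4(y)$ means $$\{f_1(x)+f_2(y):\ x,y\in\mathbb Z\}=\{f_3(x)+f_4(y):\ x,y\in\mathbb Z\}.$$ Here $T_x=\frac{x(x+1)}2$, $\psi_{a,b}(x)=\frac{x(ax+b)}2$ (for integers $a\ge1$, $b>-a$ with $a\equiv b\pmod 2$), and $p_m(x)=\frac{x((m-2)x-(m-4))}2$, so that $p_5(x)=\frac{x(3x-1)}2$ and $p_8(x)=x(3x-2)$. *)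

theory Defs
  imports Complex_Main "HOL-Computational_Algebra.Polynomial"
begin

text \<open>The polynomials here are integer-valued but have half-integral coefficients, so they live in
  \<^typ>\<open>rat poly\<close>; they are evaluated at integers embedded into the rationals.\<close>

abbreviation X :: "rat poly" where
  "X \<equiv> [:0, 1:]"

definition nat_valued :: "rat poly \<Rightarrow> bool" where
  "nat_valued f \<longleftrightarrow> (\<forall>x::int. poly f (of_int x) \<in> \<nat>)"

definition sum_values :: "rat poly \<Rightarrow> rat poly \<Rightarrow> rat set" where
  "sum_values f g = {poly f (of_int x) + poly g (of_int y) | x y :: int. True}"

text \<open>\<open>sim f\<^sub>1 f\<^sub>2 f\<^sub>3 f\<^sub>4\<close> is $f_1(x)+f_2(y)\sim f_3(x)+f_4(y)$. The notation presupposes that all four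
  polynomials map the integers into the naturals; this is made part of the relation, which is
  therefore false outside its domain.\<close>

definition sim :: "rat poly \<Rightarrow> rat poly \<Rightarrow> rat poly \<Rightarrow> rat poly \<Rightarrow> bool" where
  "sim f\<^sub>1 f\<^sub>2 f\<^sub>3 f\<^sub>4 \<longleftrightarrow>
     nat_valued f\<^sub>1 \<and> nat_valued f\<^sub>2 \<and> nat_valued f\<^sub>3 \<and> nat_valued f\<^sub>4 \<and>
     sum_values f\<^sub>1 f\<^sub>2 = sum_values f\<^sub>3 f\<^sub>4"

definition T :: "rat poly" where
  "T = smult (1/2) (X * (X + 1))"

text \<open>\<open>\<psi>\<close> is only meant for \<open>a \<ge> 1\<close>, \<open>b > -a\<close> and \<open>a\<close>, \<open>b\<close> of the same parity.\<close>

definition \<psi> :: "int \<Rightarrow> int \<Rightarrow> rat poly" where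
  "\<psi> a b = smult (1/2) (X * (of_int a * X + of_int b))"

text \<open>Generalized polygonal numbers; the subtractions are in \<^typ>\<open>rat poly\<close>, not truncated.\<close>

definition p :: "nat \<Rightarrow> rat poly" where
  "p m = smult (1/2) (X * ((of_nat m - 2) * X - (of_nat m - 4)))"

lemma poly_T: "poly T x = x * (x + 1) / 2"
  by (simp add: T_def)

lemma poly_\<psi>: "poly (\<psi> a b) x = x * (of_int a * x + of_int b) / 2"
  by (simp add: \<psi>_def of_int_poly algebra_simps)

lemma poly_p: "poly (p m) x = x * ((of_nat m - 2) * x - (of_nat m - 4)) / 2"
  by (simp add: p_def of_nat_poly algebra_simps)

lemma poly_p5: "poly (p 5) x = x * (3 * x - 1) / 2"
  by (simp add: poly_p)

lemma poly_p8: "poly (p 8) x = x * (3 * x - 2)"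
  by (simp add: poly_p field_simps)

end

theory Submission
  imports Defs
begin

text \<open>Part (i) is the substitution \<open>u = x + y\<close>, \<open>v = y - x\<close>, which reaches all pairs \<open>u\<close>, \<open>v\<close> of equal
  parity; the reflection \<open>u \<mapsto> -1 - u\<close>, under which $T_u$ is invariant, supplies the others.

  In part (ii), completing squares turns the first three claims into one statement: a positive
  integer \<open>M\<close> has the form $s^2 + 2t^2$ iff $3M = A^2 + 2B^2$ with \<open>A\<close>, \<open>B\<close> prime to 3. The passage
  is multiplication or division by $1 \pm \sqrt{-2}$, of norm 3, and it only fails when 3 divides
  both \<open>s\<close> and \<open>t\<close>. In that case a descent, dividing by 3 and multiplying by $(1 \pm \sqrt{-2})^2$,
  finds a better representation of \<open>M\<close>. The last claim is the same argument in the Gaussian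
  integers, with $2 \pm i$ of norm 5.\<close>

section \<open>The form $s^2 + 2t^2$ and the prime factors of 3\<close>

lemma primitive_square_plus_two_squares_3:
  fixes M s t :: int
  assumes "M > 0" "M = s\<^sup>2 + 2 * t\<^sup>2"
  shows "\<exists>s t. M = s\<^sup>2 + 2 * t\<^sup>2 \<and> \<not> (3 dvd s \<and> 3 dvd t)"
  using assms
proof (induction "nat M" arbitrary: M s t rule: less_induct)
  case less
  show ?case
  proof (cases "3 dvd s \<and> 3 dvd t")
    case False
    with less.prems show ?thesis by blast
  next
    case True
    then obtain s1 t1 where st: "s = 3 * s1" "t = 3 * t1" by (auto elim!: dvdE)
    define M1 where "M1 = s1\<^sup>2 + 2 * t1\<^sup>2"
    have M: "M = 9 * M1"
      using less.prems(2) by (simp add: st M1_def power2_eq_square)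
    with less.prems(1) have "M1 > 0" "nat M1 < nat M" by auto
    from less.hyps[OF this(2) this(1) M1_def]
    obtain s2 t2 where 2: "M1 = s2\<^sup>2 + 2 * t2\<^sup>2" "\<not> (3 dvd s2 \<and> 3 dvd t2)" by blast
    \<comment> \<open>The sum and the difference of the two terms are \<open>2 * s2\<close> and
      \<open>8 * t2\<close>, so 3 cannot divide both terms.\<close>
    have "\<not> 3 dvd s2 + 4 * t2 \<or> \<not> 3 dvd s2 - 4 * t2"
      using 2(2) by presburger
    moreover have "M = (s2 + 4 * t2)\<^sup>2 + 2 * (2 * s2 - t2)\<^sup>2"
      "M = (s2 - 4 * t2)\<^sup>2 + 2 * (2 * s2 + t2)\<^sup>2"
      unfolding M 2(1) by algebra+
    ultimately show ?thesis by blast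
  qed
qed

lemma square_plus_two_squares_times_3:
  fixes M s t :: int
  assumes "M > 0" "M = s\<^sup>2 + 2 * t\<^sup>2"
  obtains A B where "3 * M = A\<^sup>2 + 2 * B\<^sup>2" "\<not> 3 dvd A" "\<not> 3 dvd B"
proof -
  from primitive_square_plus_two_squares_3[OF assms]
  obtain s t where st: "M = s\<^sup>2 + 2 * t\<^sup>2" "\<not> (3 dvd s \<and> 3 dvd t)" by blast
  have "\<not> 3 dvd s - 2 * t \<and> \<not> 3 dvd s + t \<or> \<not> 3 dvd s + 2 * t \<and> \<not> 3 dvd s - t"
    using st(2) by presburger
  moreover have "3 * M = (s - 2 * t)\<^sup>2 + 2 * (s + t)\<^sup>2" "3 * M = (s + 2 * t)\<^sup>2 + 2 * (s - t)\<^sup>2"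
    unfolding st(1) by algebra+
  ultimately show ?thesis using that by blast
qed

lemma square_plus_two_squares_div_3:
  fixes M A B :: int
  assumes "3 * M = A\<^sup>2 + 2 * B\<^sup>2" "\<not> 3 dvd A" "\<not> 3 dvd B"
  obtains s t where "M = s\<^sup>2 + 2 * t\<^sup>2"
proof -
  have main: "\<exists>s t. M = s\<^sup>2 + 2 * t\<^sup>2" if "3 dvd C - A" "C\<^sup>2 = B\<^sup>2" for C
  proof -
    obtain k where k: "C = A + 3 * k" using \<open>3 dvd C - A\<close> by (auto elim!: dvdE simp: algebra_simps)
    have "3 * M = 3 * ((A + 2 * k)\<^sup>2 + 2 * k\<^sup>2)"
      unfolding assms(1) that(2)[symmetric] k by algebra
    hence "M = (A + 2 * k)\<^sup>2 + 2 * k\<^sup>2" by simp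
    thus ?thesis by blast
  qed
  have "3 dvd B - A \<or> 3 dvd - B - A" using assms(2,3) by presburger
  hence "\<exists>s t. M = s\<^sup>2 + 2 * t\<^sup>2" using main[of B] main[of "- B"] by auto
  thus thesis using that by blast
qed

section \<open>Sums of two squares and the prime factors of 5\<close>

lemma primitive_sum_two_squares_5:
  fixes M r s :: int
  assumes "M > 0" "M = r\<^sup>2 + s\<^sup>2"
  shows "\<exists>r s. M = r\<^sup>2 + s\<^sup>2 \<and> \<not> (5 dvd r \<and> 5 dvd s)"
  using assms
proof (induction "nat M" arbitrary: M r s rule: less_induct)
  case less
  show ?case
  proof (cases "5 dvd r \<and> 5 dvd s")
    case False
    with less.prems show ?thesis by blast
  next
    case True
    then obtain r1 s1 where rs: "r = 5 * r1" "s = 5 * s1" by (auto elim!: dvdE)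
    define M1 where "M1 = r1\<^sup>2 + s1\<^sup>2"
    have M: "M = 25 * M1"
      using less.prems(2) by (simp add: rs M1_def power2_eq_square)
    with less.prems(1) have "M1 > 0" "nat M1 < nat M" by auto
    from less.hyps[OF this(2) this(1) M1_def]
    obtain r2 s2 where 2: "M1 = r2\<^sup>2 + s2\<^sup>2" "\<not> (5 dvd r2 \<and> 5 dvd s2)" by blast
    have "\<not> 5 dvd 3 * r2 + 4 * s2 \<or> \<not> 5 dvd 3 * r2 - 4 * s2"
      using 2(2) by presburger
    moreover have "M = (3 * r2 + 4 * s2)\<^sup>2 + (4 * r2 - 3 * s2)\<^sup>2"
      "M = (3 * r2 - 4 * s2)\<^sup>2 + (4 * r2 + 3 * s2)\<^sup>2"
      unfolding M 2(1) by algebra+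
    ultimately show ?thesis by blast
  qed
qed

text \<open>The congruence between \<open>B\<close> and \<open>2 * A\<close> says that $A + Bi$ is
  divisible by $1 + 2i$ rather than merely by its conjugate. It also fixes the residue of
  \<open>B\<close> modulo 5 in terms of that of \<open>A\<close>.\<close>

lemma sum_two_squares_times_5:
  fixes M r s :: int
  assumes "M > 0" "M = r\<^sup>2 + s\<^sup>2"
  obtains A B where "5 * M = A\<^sup>2 + B\<^sup>2" "5 dvd B - 2 * A" "\<not> 5 dvd A"
proof -
  from primitive_sum_two_squares_5[OF assms]
  obtain r s where rs: "M = r\<^sup>2 + s\<^sup>2" "\<not> (5 dvd r \<and> 5 dvd s)" by blast
  have "\<not> 5 dvd r + 2 * s \<or> \<not> 5 dvd r - 2 * s"
    using rs(2) by presburger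
  moreover have "5 * M = (r + 2 * s)\<^sup>2 + (2 * r - s)\<^sup>2" "5 * M = (r - 2 * s)\<^sup>2 + (2 * r + s)\<^sup>2"
    unfolding rs(1) by algebra+
  moreover have "5 dvd (2 * r - s) - 2 * (r + 2 * s)" "5 dvd (2 * r + s) - 2 * (r - 2 * s)"
    by presburger+
  ultimately show ?thesis using that by blast
qed

lemma sum_two_squares_div_5:
  fixes M A B :: int
  assumes "5 * M = A\<^sup>2 + B\<^sup>2" "5 dvd B - 2 * A"
  obtains r s where "M = r\<^sup>2 + s\<^sup>2"
proof -
  obtain k where k: "B = 2 * A + 5 * k" using assms(2) by (auto elim!: dvdE simp: algebra_simps)
  \<comment> \<open>The quotient of $A + Bi$ by $1 + 2i$ is $(A + 2k) + ki$.\<close>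
  have "5 * M = 5 * ((A + 2 * k)\<^sup>2 + k\<^sup>2)"
    unfolding assms(1) k by algebra
  hence "M = (A + 2 * k)\<^sup>2 + k\<^sup>2" by simp
  thus thesis by (rule that)
qed

section \<open>Residue classes up to sign\<close>

text \<open>Only squares enter the representations, so of \<open>B\<close> and \<open>- B\<close>
  the one in the wanted residue class may be taken. The next three lemmas do the same modulo 6 and
  10.\<close>

lemma square_of_3x_minus_1:
  fixes B :: int
  assumes "\<not> 3 dvd B"
  obtains v where "B\<^sup>2 = (3 * v - 1)\<^sup>2"
proof -
  have "\<exists>v. B = 3 * v - 1 \<or> - B = 3 * v - 1" using assms by presburger
  thus thesis using that by (metis power2_minus)
qed

lemma square_of_6x_minus_1:
  fixes A :: int
  assumes "odd A" "\<not> 3 dvd A"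
  obtains u where "A\<^sup>2 = (6 * u - 1)\<^sup>2"
proof -
  have "\<exists>u. A = 6 * u - 1 \<or> - A = 6 * u - 1" using assms by presburger
  thus thesis using that by (metis power2_minus)
qed

lemma square_of_10x_plus_1:
  fixes A :: int
  assumes "A mod 10 \<in> {1, 9}"
  obtains u where "A\<^sup>2 = (10 * u + 1)\<^sup>2"
proof -
  have "A mod 10 = 1 \<or> A mod 10 = 9" using assms by simp
  hence "\<exists>u. A = 10 * u + 1 \<or> - A = 10 * u + 1" by presburger
  thus thesis using that by (metis power2_minus)
qed

lemma square_of_10x_plus_3:
  fixes A :: int
  assumes "A mod 10 \<in> {3, 7}"
  obtains u where "A\<^sup>2 = (10 * u + 3)\<^sup>2"
proof -
  have "A mod 10 = 3 \<or> A mod 10 = 7" using assms by simp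
  hence "\<exists>u. A = 10 * u + 3 \<or> - A = 10 * u + 3" by presburger
  thus thesis using that by (metis power2_minus)
qed

section \<open>The equivalences of part (ii), for doubled values\<close>

text \<open>Completing squares turns the left side into a representation of \<open>4 * N + 1\<close>
  with \<open>t\<close> even, the right side into one of \<open>3 * (4 * N + 1)\<close> by squares
  of numbers \<open>6 * u - 1\<close> and \<open>6 * v - 1\<close>. The parities are forced modulo
  4.\<close>

lemma pentagonal_sum_iff:
  fixes N :: int
  assumes "even N" "N \<ge> 0"
  shows "(\<exists>x y. N = 2 * x\<^sup>2 + y * (y + 1)) \<longleftrightarrow>
    (\<exists>u v. N = u * (3 * u - 1) + 2 * (v * (3 * v - 1)))"
proof (intro iffI; elim exE)
  fix x y assume "N = 2 * x\<^sup>2 + y * (y + 1)"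
  hence "4 * N + 1 = (2 * y + 1)\<^sup>2 + 2 * (2 * x)\<^sup>2" by algebra
  moreover have "4 * N + 1 > 0" using assms by simp
  ultimately obtain A B where AB: "3 * (4 * N + 1) = A\<^sup>2 + 2 * B\<^sup>2" "\<not> 3 dvd A" "\<not> 3 dvd B"
    using square_plus_two_squares_times_3 by blast
  have "even (A\<^sup>2) \<longleftrightarrow> even (3 * (4 * N + 1))" unfolding AB(1) by simp
  hence "odd A" by simp
  \<comment> \<open>\<open>12 * N + 3\<close> is 3 modulo 4, whereas an odd \<open>A\<close> and an
    even \<open>B\<close> would give 1.\<close>
  have "odd B"
  proof
    assume "even B"
    then obtain k l where "B = 2 * k" "A = 2 * l + 1" using \<open>odd A\<close> by (auto elim!: evenE oddE)
    with AB(1) have "6 * N + 1 = 2 * (l\<^sup>2 + l + 2 * k\<^sup>2)" by (simp add: power2_eq_square algebra_simps)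
    thus False by presburger
  qed
  obtain u v where "A\<^sup>2 = (6 * u - 1)\<^sup>2" "B\<^sup>2 = (6 * v - 1)\<^sup>2"
    using square_of_6x_minus_1 AB(2,3) \<open>odd A\<close> \<open>odd B\<close> by metis
  with AB(1) have "N = u * (3 * u - 1) + 2 * (v * (3 * v - 1))"
    by (simp add: power2_eq_square algebra_simps)
  thus "\<exists>u v. N = u * (3 * u - 1) + 2 * (v * (3 * v - 1))" by blast
next
  fix u v assume "N = u * (3 * u - 1) + 2 * (v * (3 * v - 1))"
  hence "3 * (4 * N + 1) = (6 * u - 1)\<^sup>2 + 2 * (6 * v - 1)\<^sup>2" by algebra
  moreover have "\<not> 3 dvd 6 * u - 1" "\<not> 3 dvd 6 * v - 1" by presburger+
  ultimately obtain s t where st: "4 * N + 1 = s\<^sup>2 + 2 * t\<^sup>2"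
    by (rule square_plus_two_squares_div_3)
  have "even (s\<^sup>2) \<longleftrightarrow> even (4 * N + 1)" unfolding st by simp
  then obtain y where y: "s = 2 * y + 1" by (auto elim!: oddE)
  have "t\<^sup>2 = 2 * (N - (y\<^sup>2 + y))" using st by (simp add: y power2_eq_square algebra_simps)
  hence "even (t\<^sup>2)" by simp
  then obtain x where "t = 2 * x" by (auto elim!: evenE)
  with st y have "N = 2 * x\<^sup>2 + y * (y + 1)" by (simp add: power2_eq_square algebra_simps)
  thus "\<exists>x y. N = 2 * x\<^sup>2 + y * (y + 1)" by blast
qed

text \<open>Here the number represented is \<open>4 * N + 3\<close>. Modulo 4 it forces both
  coordinates to be odd, while \<open>3 * (4 * N + 3)\<close>, being 1 modulo 4, forces the second
  one to be even; its half accounts for the octagonal number.\<close>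

lemma pentagonal_octagonal_sum_iff:
  fixes N :: int
  assumes "even N" "N \<ge> 0"
  shows "(\<exists>x y. N = x * (x + 1) + 2 * (y * (y + 1))) \<longleftrightarrow>
    (\<exists>u v. N = u * (3 * u - 1) + 2 * (v * (3 * v - 2)))"
proof (intro iffI; elim exE)
  fix x y assume "N = x * (x + 1) + 2 * (y * (y + 1))"
  hence "4 * N + 3 = (2 * x + 1)\<^sup>2 + 2 * (2 * y + 1)\<^sup>2" by algebra
  moreover have "4 * N + 3 > 0" using assms by simp
  ultimately obtain A C where AC: "3 * (4 * N + 3) = A\<^sup>2 + 2 * C\<^sup>2" "\<not> 3 dvd A" "\<not> 3 dvd C"
    using square_plus_two_squares_times_3 by blast
  have "even (A\<^sup>2) \<longleftrightarrow> even (3 * (4 * N + 3))" unfolding AC(1) by simp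
  then have "odd A" by simp
  then obtain k where k: "A = 2 * k + 1" by (auto elim!: oddE)
  have "C\<^sup>2 = 2 * (3 * N + 2 - (k\<^sup>2 + k))" using AC(1) by (simp add: k power2_eq_square algebra_simps)
  hence "even (C\<^sup>2)" by simp
  then obtain B where B: "C = 2 * B" by (auto elim!: evenE)
  with AC(3) have "\<not> 3 dvd B" by presburger
  obtain u v where "A\<^sup>2 = (6 * u - 1)\<^sup>2" "B\<^sup>2 = (3 * v - 1)\<^sup>2"
    using square_of_6x_minus_1 square_of_3x_minus_1 AC(2) \<open>odd A\<close> \<open>\<not> 3 dvd B\<close> by metis
  with AC(1) B have "N = u * (3 * u - 1) + 2 * (v * (3 * v - 2))"
    by (simp add: power2_eq_square algebra_simps)
  thus "\<exists>u v. N = u * (3 * u - 1) + 2 * (v * (3 * v - 2))" by blast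
next
  fix u v assume "N = u * (3 * u - 1) + 2 * (v * (3 * v - 2))"
  hence "3 * (4 * N + 3) = (6 * u - 1)\<^sup>2 + 2 * (2 * (3 * v - 1))\<^sup>2" by algebra
  moreover have "\<not> 3 dvd 6 * u - 1" "\<not> 3 dvd 2 * (3 * v - 1)" by presburger+
  ultimately obtain r s where rs: "4 * N + 3 = r\<^sup>2 + 2 * s\<^sup>2"
    by (rule square_plus_two_squares_div_3)
  have "even (r\<^sup>2) \<longleftrightarrow> even (4 * N + 3)" unfolding rs by simp
  then obtain x where x: "r = 2 * x + 1" by (auto elim!: oddE)
  have "s\<^sup>2 = 2 * (N - (x\<^sup>2 + x)) + 1" using rs by (simp add: x power2_eq_square algebra_simps)
  hence "odd (s\<^sup>2)" by simp
  then obtain y where "s = 2 * y + 1" by (auto elim!: oddE)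
  with rs x have "N = x * (x + 1) + 2 * (y * (y + 1))" by (simp add: power2_eq_square algebra_simps)
  thus "\<exists>x y. N = x * (x + 1) + 2 * (y * (y + 1))" by blast
qed

text \<open>The number represented is \<open>N + 1\<close>, odd because \<open>N\<close> is even.
  This makes the first coordinate odd and leaves the parity of the second one free, which suits both
  $x^2$ and the octagonal numbers.\<close>

lemma four_pentagonal_octagonal_sum_iff:
  fixes N :: int
  assumes "even N" "N \<ge> 0"
  shows "(\<exists>x y. N = 2 * x\<^sup>2 + 4 * (y * (y + 1))) \<longleftrightarrow>
    (\<exists>u v. N = 4 * (u * (3 * u - 1)) + 2 * (v * (3 * v - 2)))"
proof (intro iffI; elim exE)
  fix x y assume "N = 2 * x\<^sup>2 + 4 * (y * (y + 1))"
  hence "N + 1 = (2 * y + 1)\<^sup>2 + 2 * x\<^sup>2" by algebra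
  moreover have "N + 1 > 0" using assms by simp
  ultimately obtain A B where AB: "3 * (N + 1) = A\<^sup>2 + 2 * B\<^sup>2" "\<not> 3 dvd A" "\<not> 3 dvd B"
    using square_plus_two_squares_times_3 by blast
  have "even (A\<^sup>2) \<longleftrightarrow> even (3 * (N + 1))" unfolding AB(1) by simp
  hence "odd A" using assms(1) by simp
  obtain u v where "A\<^sup>2 = (6 * u - 1)\<^sup>2" "B\<^sup>2 = (3 * v - 1)\<^sup>2"
    using square_of_6x_minus_1 square_of_3x_minus_1 AB(2,3) \<open>odd A\<close> by metis
  with AB(1) have "N = 4 * (u * (3 * u - 1)) + 2 * (v * (3 * v - 2))"
    by (simp add: power2_eq_square algebra_simps)
  thus "\<exists>u v. N = 4 * (u * (3 * u - 1)) + 2 * (v * (3 * v - 2))" by blast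
next
  fix u v assume "N = 4 * (u * (3 * u - 1)) + 2 * (v * (3 * v - 2))"
  hence "3 * (N + 1) = (6 * u - 1)\<^sup>2 + 2 * (3 * v - 1)\<^sup>2" by algebra
  moreover have "\<not> 3 dvd 6 * u - 1" "\<not> 3 dvd 3 * v - 1" by presburger+
  ultimately obtain s t where st: "N + 1 = s\<^sup>2 + 2 * t\<^sup>2"
    by (rule square_plus_two_squares_div_3)
  have "even (s\<^sup>2) \<longleftrightarrow> even (N + 1)" unfolding st by simp
  then obtain y where "s = 2 * y + 1" using assms(1) by (auto elim!: oddE)
  with st have "N = 2 * t\<^sup>2 + 4 * (y * (y + 1))" by (simp add: power2_eq_square algebra_simps)
  thus "\<exists>x y. N = 2 * x\<^sup>2 + 4 * (y * (y + 1))" by blast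
qed

text \<open>Completing squares gives two odd squares with sum \<open>4 * N + 2\<close> on the left,
  and $(10u+1)^2 + (10v+3)^2$ with sum \<open>5 * (4 * N + 2)\<close> on the right.\<close>

lemma psi_5_sum_iff:
  fixes N :: int
  assumes "N \<ge> 0"
  shows "(\<exists>x y. N = x * (x + 1) + y * (y + 1)) \<longleftrightarrow>
    (\<exists>u v. N = u * (5 * u + 1) + v * (5 * v + 3))"
proof (intro iffI; elim exE)
  fix x y assume "N = x * (x + 1) + y * (y + 1)"
  hence "4 * N + 2 = (2 * x + 1)\<^sup>2 + (2 * y + 1)\<^sup>2" by algebra
  moreover have "4 * N + 2 > 0" using assms by simp
  ultimately obtain A B where AB: "5 * (4 * N + 2) = A\<^sup>2 + B\<^sup>2" "5 dvd B - 2 * A" "\<not> 5 dvd A"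
    using sum_two_squares_times_5 by blast
  have "even (A\<^sup>2 + B\<^sup>2)" unfolding AB(1)[symmetric] by simp
  hence parity: "even A \<longleftrightarrow> even B" by simp
  \<comment> \<open>\<open>20 * N + 10\<close> is not divisible by 4.\<close>
  have odd: "odd A"
  proof
    assume "even A"
    with parity obtain k l where "A = 2 * k" "B = 2 * l" by (auto elim!: evenE)
    with AB(1) have "10 * N + 5 = 2 * (k\<^sup>2 + l\<^sup>2)" by (simp add: power2_eq_square algebra_simps)
    thus False by presburger
  qed
  \<comment> \<open>For odd numbers prime to 5, the congruence of \<open>B\<close> with
    \<open>2 * A\<close> modulo 5 interchanges the classes of 1 and 3 modulo 10, taken up to
    sign.\<close>
  have "A mod 10 \<in> {1, 9} \<and> B mod 10 \<in> {3, 7} \<or> B mod 10 \<in> {1, 9} \<and> A mod 10 \<in> {3, 7}"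
  proof -
    have "A mod 10 = 1 \<or> A mod 10 = 9 \<or> A mod 10 = 3 \<or> A mod 10 = 7"
      using odd AB(3) by presburger
    moreover have "A mod 10 = 1 \<Longrightarrow> B mod 10 = 7" "A mod 10 = 9 \<Longrightarrow> B mod 10 = 3"
      "A mod 10 = 3 \<Longrightarrow> B mod 10 = 1" "A mod 10 = 7 \<Longrightarrow> B mod 10 = 9"
      using AB(2) parity by presburger+
    ultimately show ?thesis by blast
  qed
  hence "\<exists>u v. A\<^sup>2 + B\<^sup>2 = (10 * u + 1)\<^sup>2 + (10 * v + 3)\<^sup>2"
  proof (elim disjE conjE)
    assume "A mod 10 \<in> {1, 9}" "B mod 10 \<in> {3, 7}"
    then obtain u v where "A\<^sup>2 = (10 * u + 1)\<^sup>2" "B\<^sup>2 = (10 * v + 3)\<^sup>2"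
      using square_of_10x_plus_1 square_of_10x_plus_3 by metis
    hence "A\<^sup>2 + B\<^sup>2 = (10 * u + 1)\<^sup>2 + (10 * v + 3)\<^sup>2" by simp
    thus ?thesis by blast
  next
    assume "B mod 10 \<in> {1, 9}" "A mod 10 \<in> {3, 7}"
    then obtain u v where "B\<^sup>2 = (10 * u + 1)\<^sup>2" "A\<^sup>2 = (10 * v + 3)\<^sup>2"
      using square_of_10x_plus_1 square_of_10x_plus_3 by metis
    hence "A\<^sup>2 + B\<^sup>2 = (10 * u + 1)\<^sup>2 + (10 * v + 3)\<^sup>2" by simp
    thus ?thesis by blast
  qed
  then obtain u v where "A\<^sup>2 + B\<^sup>2 = (10 * u + 1)\<^sup>2 + (10 * v + 3)\<^sup>2" by blast
  with AB(1) have "N = u * (5 * u + 1) + v * (5 * v + 3)"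
    by (simp add: power2_eq_square algebra_simps)
  thus "\<exists>u v. N = u * (5 * u + 1) + v * (5 * v + 3)" by blast
next
  fix u v assume "N = u * (5 * u + 1) + v * (5 * v + 3)"
  \<comment> \<open>The minus sign is chosen because -3, not 3, is twice 1 modulo 5.\<close>
  hence "5 * (4 * N + 2) = (10 * u + 1)\<^sup>2 + (- (10 * v + 3))\<^sup>2" by algebra
  moreover have "5 dvd - (10 * v + 3) - 2 * (10 * u + 1)" by presburger
  ultimately obtain r s where rs: "4 * N + 2 = r\<^sup>2 + s\<^sup>2"
    by (rule sum_two_squares_div_5)
  have "even (r\<^sup>2 + s\<^sup>2)" unfolding rs[symmetric] by simp
  hence parity: "even r \<longleftrightarrow> even s" by simp
  have "odd r"
  proof
    assume "even r"
    with parity obtain k l where "r = 2 * k" "s = 2 * l" by (auto elim!: evenE)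
    with rs have "2 * N + 1 = 2 * (k\<^sup>2 + l\<^sup>2)" by (simp add: power2_eq_square algebra_simps)
    thus False by presburger
  qed
  with parity obtain x y where "r = 2 * x + 1" "s = 2 * y + 1" by (auto elim!: oddE)
  with rs have "N = x * (x + 1) + y * (y + 1)" by (simp add: power2_eq_square algebra_simps)
  thus "\<exists>x y. N = x * (x + 1) + y * (y + 1)" by blast
qed

section \<open>The substitution of part (i), for doubled values\<close>

lemma triangular_psi_sum_iff:
  fixes a b N :: int
  shows "(\<exists>x y. N = 2 * (x * (a * x + b)) + 2 * (y * (a * y + a - b))) \<longleftrightarrow>
    (\<exists>u v. N = a * (u * (u + 1)) + v * (a * v + (a - 2 * b)))"
proof (intro iffI; elim exE)
  fix x y assume "N = 2 * (x * (a * x + b)) + 2 * (y * (a * y + a - b))"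
  hence "N = a * ((x + y) * ((x + y) + 1)) + (y - x) * (a * (y - x) + (a - 2 * b))" by algebra
  thus "\<exists>u v. N = a * (u * (u + 1)) + v * (a * v + (a - 2 * b))" by blast
next
  have same_parity: "\<exists>x y. N = 2 * (x * (a * x + b)) + 2 * (y * (a * y + a - b))"
    if N: "N = a * (u * (u + 1)) + v * (a * v + (a - 2 * b))" and "even (u - v)" for u v
  proof -
    obtain x where "u - v = 2 * x" using \<open>even (u - v)\<close> by (elim evenE)
    hence u: "u = v + 2 * x" by simp
    \<comment> \<open>With $x = (u - v)/2$, the term \<open>v + x\<close> is $y = (u +
      v)/2$.\<close>
    have "N = 2 * (x * (a * x + b)) + 2 * ((v + x) * (a * (v + x) + a - b))"
      unfolding N u by algebra
    thus ?thesis by blast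
  qed
  fix u v assume N: "N = a * (u * (u + 1)) + v * (a * v + (a - 2 * b))"
  show "\<exists>x y. N = 2 * (x * (a * x + b)) + 2 * (y * (a * y + a - b))"
  proof (cases "even (u - v)")
    case True
    with N show ?thesis by (rule same_parity)
  next
    case False
    hence "even ((- 1 - u) - v)" by presburger
    moreover have "N = a * ((- 1 - u) * ((- 1 - u) + 1)) + v * (a * v + (a - 2 * b))"
      unfolding N by algebra
    ultimately show ?thesis using same_parity by blast
  qed
qed

section \<open>Non-negativity, and the return from doubled values to polynomials\<close>

text \<open>For an integer \<open>x\<close> other than 0, the term \<open>a * x\<close> dominates
  \<open>b\<close>, so the two factors never have opposite signs.\<close>

lemma quadratic_int_nonneg:
  fixes a b x :: int
  assumes "\<bar>b\<bar> \<le> a"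
  shows "0 \<le> x * (a * x + b)"
proof -
  consider "x = 0" | "x \<ge> 1" | "x \<le> - 1" by linarith
  thus ?thesis
  proof cases
    case 2
    hence "a * 1 \<le> a * x" using assms by (intro mult_left_mono) auto
    thus ?thesis using 2 assms by (intro mult_nonneg_nonneg) auto
  next
    case 3
    hence "a * x \<le> a * (- 1)" using assms by (intro mult_left_mono) auto
    thus ?thesis using 3 assms by (intro mult_nonpos_nonpos) auto
  qed auto
qed

text \<open>The integer functions \<open>g\<^sub>i\<close> are the doubled values, so that no denominators remain.\<close>

lemma simI:
  fixes g1 g2 g3 g4 :: "int \<Rightarrow> int"
  assumes eval: "\<And>x. poly f1 (of_int x) = of_int (g1 x) / 2" "\<And>x. poly f2 (of_int x) = of_int (g2 x) / 2"
      "\<And>x. poly f3 (of_int x) = of_int (g3 x) / 2" "\<And>x. poly f4 (of_int x) = of_int (g4 x) / 2"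
    and even: "\<And>x. even (g1 x)" "\<And>x. even (g2 x)" "\<And>x. even (g3 x)" "\<And>x. even (g4 x)"
    and nonneg: "\<And>x. g1 x \<ge> 0" "\<And>x. g2 x \<ge> 0" "\<And>x. g3 x \<ge> 0" "\<And>x. g4 x \<ge> 0"
    and iff: "\<And>N. even N \<Longrightarrow> N \<ge> 0 \<Longrightarrow>
      (\<exists>x y. N = g1 x + g2 y) \<longleftrightarrow> (\<exists>u v. N = g3 u + g4 v)"
  shows "sim f1 f2 f3 f4"
proof -
  have nat_valued: "nat_valued f" if "\<And>x. poly f (of_int x) = of_int (g x) / 2"
    "\<And>x. even (g x)" "\<And>x. g x \<ge> 0" for f and g :: "int \<Rightarrow> int"
    unfolding nat_valued_def
  proof
    fix x
    obtain k where "g x = 2 * k" using \<open>even (g x)\<close> by (elim evenE)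
    with that(1)[of x] that(3)[of x] have "poly f (of_int x) = of_nat (nat k)" by simp
    thus "poly f (of_int x) \<in> \<nat>" by simp
  qed
  \<comment> \<open>Every sum \<open>h x + k y\<close> is even and non-negative. Recording this in
    the set allows the equivalence, assumed for such \<open>N\<close>, to be applied.\<close>
  have sum_values: "sum_values f g = (\<lambda>N. of_int N / 2) ` {N. even N \<and> N \<ge> 0 \<and> (\<exists>x y. N = h x + k y)}"
    if "\<And>x. poly f (of_int x) = of_int (h x) / 2" "\<And>x. poly g (of_int x) = of_int (k x) / 2"
      "\<And>x. even (h x)" "\<And>x. even (k x)" "\<And>x. h x \<ge> 0" "\<And>x. k x \<ge> 0"
    for f g and h k :: "int \<Rightarrow> int"
  proof -
    have "poly f (of_int x) + poly g (of_int y) = of_int (h x + k y) / 2" for x y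
      unfolding that(1,2) by (simp add: add_divide_distrib)
    hence "sum_values f g = {of_int (h x + k y) / 2 | x y. True}"
      unfolding sum_values_def by presburger
    also have "\<dots> = (\<lambda>N. of_int N / 2) ` {h x + k y | x y. True}"
      by blast
    also have "{h x + k y | x y. True} = {N. even N \<and> N \<ge> 0 \<and> (\<exists>x y. N = h x + k y)}"
    proof -
      have "even (h x + k y)" "h x + k y \<ge> 0" for x y
        using that(3-6) by simp_all
      thus ?thesis by blast
    qed
    finally show ?thesis .
  qed
  have "{N. even N \<and> N \<ge> 0 \<and> (\<exists>x y. N = g1 x + g2 y)} =
      {N. even N \<and> N \<ge> 0 \<and> (\<exists>u v. N = g3 u + g4 v)}"
    using iff by blast
  hence "sum_values f1 f2 = sum_values f3 f4"
    using sum_values[of f1 g1 f2 g2] sum_values[of f3 g3 f4 g4] eval even nonneg by simp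
  thus ?thesis
    unfolding sim_def using eval even nonneg nat_valued by blast
qed

lemma triangular_nonneg: "0 \<le> x * (x + 1)" for x :: int
  using quadratic_int_nonneg[of 1 1 x] by simp

lemma pentagonal_nonneg: "0 \<le> x * (3 * x - 1)" for x :: int
  using quadratic_int_nonneg[of "-1" 3 x] by simp

lemma octagonal_nonneg: "0 \<le> x * (3 * x - 2)" for x :: int
  using quadratic_int_nonneg[of "-2" 3 x] by simp

theorem theorem1p9:
  "(\<forall>a b :: int. a \<ge> 1 \<and> b \<ge> 0 \<and> (of_int b :: rat) \<le> of_int a / 2 \<longrightarrow>
      sim (X * (of_int a * X + of_int b)) (X * (of_int a * X + of_int a - of_int b))
          (of_int a * T) (\<psi> a (a - 2 * b)))
   \<and> sim (X\<^sup>2) T (p 5) (2 * p 5)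
   \<and> sim T (2 * T) (p 5) (p 8)
   \<and> sim (X\<^sup>2) (4 * T) (4 * p 5) (p 8)
   \<and> sim T T (\<psi> 5 1) (\<psi> 5 3)"
proof (intro conjI allI impI)
  fix a b :: int
  assume "a \<ge> 1 \<and> b \<ge> 0 \<and> (of_int b :: rat) \<le> of_int a / 2"
  hence "a \<ge> 1" "b \<ge> 0" "(of_int (2 * b) :: rat) \<le> of_int a" by auto
  hence ab: "a \<ge> 1" "b \<ge> 0" "2 * b \<le> a" by (simp_all only: of_int_le_iff)
  show "sim (X * (of_int a * X + of_int b)) (X * (of_int a * X + of_int a - of_int b))
          (of_int a * T) (\<psi> a (a - 2 * b))"
  \<comment> \<open>The equivalence determines the four doubled functions; their evaluation, parity
    and sign remain.\<close>
  proof (rule simI[OF _ _ _ _ _ _ _ _ _ _ _ _ triangular_psi_sum_iff[of _ a b]])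
    fix x :: int
    show "0 \<le> 2 * (x * (a * x + b))"
      using quadratic_int_nonneg[of b a x] ab by simp
    show "0 \<le> 2 * (x * (a * x + a - b))"
      using quadratic_int_nonneg[of "a - b" a x] ab by (simp add: algebra_simps)
    show "0 \<le> a * (x * (x + 1))"
      using triangular_nonneg ab by simp
    show "0 \<le> x * (a * x + (a - 2 * b))"
      using quadratic_int_nonneg[of "a - 2 * b" a x] ab by simp
  qed (auto simp: poly_T poly_\<psi> of_int_poly)
next
  show "sim (X\<^sup>2) T (p 5) (2 * p 5)"
    by (rule simI[OF _ _ _ _ _ _ _ _ _ _ _ _ pentagonal_sum_iff])
      (auto simp: poly_T poly_p5 triangular_nonneg pentagonal_nonneg)
  show "sim T (2 * T) (p 5) (p 8)"
    by (rule simI[OF _ _ _ _ _ _ _ _ _ _ _ _ pentagonal_octagonal_sum_iff])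
      (auto simp: poly_T poly_p5 poly_p8 triangular_nonneg pentagonal_nonneg octagonal_nonneg)
  show "sim (X\<^sup>2) (4 * T) (4 * p 5) (p 8)"
    by (rule simI[OF _ _ _ _ _ _ _ _ _ _ _ _ four_pentagonal_octagonal_sum_iff])
      (auto simp: poly_T poly_p5 poly_p8 triangular_nonneg pentagonal_nonneg octagonal_nonneg)
  show "sim T T (\<psi> 5 1) (\<psi> 5 3)"
    by (rule simI[OF _ _ _ _ _ _ _ _ _ _ _ _ psi_5_sum_iff])
      (auto simp: poly_T poly_\<psi> triangular_nonneg quadratic_int_nonneg)
qed

end
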